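(* Let $k\ge2$, $g\in C^k(\mathbb{R}^n)$ and $u(x,t)=\min_{|x-y|\le t}g(y)$. For any point $(x,t)\in(\mathbb{R}^n\times\{t>0\})\setminus(\Sigma\cup T_1\cup P^0)$ there exists a neighborhood $U$ of $(x,t)$ such that $u\in C^k(U)$.
   Context: $|\cdot|$ is the Euclidean norm. $u$ is the Hopf–Lax solution of $u_t+|\nabla u|=0$ with $u(\cdot,0)=g$. A point $y$ is a minimizer for $(x,t)$ if $|y-x|\le t$ and $u(x,t)=g(y)$. For $y_0$ with $Dg(y_0)\ne0$ put $X(y_0,t)=y_0+\frac{Dg(y_0)}{|Dg(y_0)|}t$ and define, in $[0,\infty]$, $\overline t_s(y_0)=\sup\{t>0 : y_0$ is the unique minimizer for $(X(y_0,t),t)\}$ and $t_s(y_0)=\inf\{t>0 : y_0$ is not a minimizer for $(X(y_0,t),t)\}$ (with $\sup\emptyset=0$, $\inf\emptyset=\infty$); one has $\overline t_s\le t_s$. $M=\{y_0 : Dg(y_0)\neq0,\ \overline t_s(y_0)<\infty\}$, and $T(M)$ is the set of points $(X(y_0,t),t)$ with $y_0\in M$ and $t\in[\overline t_s(y_0),t_s(y_0)]$ if $t_s(y_0)<\infty$, $t\in[\overline t_s(y_0),\infty)$ if $t_s(y_0)=\infty$. For $y_0$ with $Dg(y_0)=0$ and $P\in\mathbb{R}^n$ with $|P|\le1$, $t_s(y_0,P)=\inf\{t>0 : y_0$ is not a minimizer for $(y_0+tP,t)\}\in[0,\infty]$ (with $\inf\emptyset=\infty$). $\Sigma\subset\mathbb{R}^n\times\{t>0\}$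 is the set of points where $u$ is not differentiable. $T_1$ is the set of points of $T(M)$ that have a unique minimizer. $P^0=\{(x,t) : x=y_0+Pt,\ t\in[0,t_s(y_0,P)],\ Dg(y_0)=0,\ |P|=1\}$, where $[0,t_s(y_0,P)]$ is read as $[0,\infty)$ if $t_s(y_0,P)=\infty$. *)

theory Defs
  imports "HOL-Analysis.Analysis"
begin

text \<open>
  \<open>Ck_on k f S\<close> is meant for open \<open>S\<close>: all iterated directional derivatives of
  \<open>f\<close> of order less than \<open>k\<close> are (totally) differentiable on \<open>S\<close>, and those of order
  \<open>k\<close> are continuous on \<open>S\<close>.
\<close>

primrec Ck_on ::
  "nat \<Rightarrow> ('a::real_normed_vector \<Rightarrow> 'b::real_normed_vector) \<Rightarrow> 'a set \<Rightarrow> bool" where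
  "Ck_on 0 f S \<longleftrightarrow> continuous_on S f"
| "Ck_on (Suc k) f S \<longleftrightarrow>
     (\<forall>x\<in>S. f differentiable (at x)) \<and>
     (\<forall>v. Ck_on k (\<lambda>x. frechet_derivative f (at x) v) S)"

definition grad :: "('a::real_inner \<Rightarrow> real) \<Rightarrow> 'a \<Rightarrow> 'a" where
  "grad g y = (THE D. GDERIV g y :> D)"

definition hopf_lax :: "('a::euclidean_space \<Rightarrow> real) \<Rightarrow> 'a \<times> real \<Rightarrow> real" where
  "hopf_lax g = (\<lambda>(x, t). INF y\<in>{y. norm (x - y) \<le> t}. g y)"

text \<open>The infimum is a minimum in the relevant situation (continuous \<open>g\<close> and \<open>t \<ge> 0\<close>).\<close>

lemma hopf_lax_is_min:
  fixes g :: "'a::euclidean_space \<Rightarrow> real"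
  assumes "continuous_on UNIV g" "0 \<le> t"
  shows "\<exists>y. norm (x - y) \<le> t \<and> hopf_lax g (x, t) = g y \<and> (\<forall>z. norm (x - z) \<le> t \<longrightarrow> g y \<le> g z)"
proof -
  have S: "{y. norm (x - y) \<le> t} = cball x t"
    by (auto simp: dist_norm)
  have "continuous_on (cball x t) g"
    using assms(1) continuous_on_subset by blast
  with assms(2) obtain y where y: "y \<in> cball x t" "\<forall>z\<in>cball x t. g y \<le> g z"
    using continuous_attains_inf[of "cball x t" g] by auto
  have "(INF y\<in>cball x t. g y) = g y"
    by (rule cInf_eq_minimum) (use y in auto)
  then have "hopf_lax g (x, t) = g y"
    by (simp add: hopf_lax_def S)
  with y show ?thesis
    by (intro exI[of _ y]) (auto simp: dist_norm)
qed

definition minimizer :: "('a::euclidean_space \<Rightarrow> real) \<Rightarrow> 'a \<Rightarrow> 'a \<times> real \<Rightarrow> bool" where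
  "minimizer g y = (\<lambda>(x, t). norm (y - x) \<le> t \<and> hopf_lax g (x, t) = g y)"

definition unique_minimizer :: "('a::euclidean_space \<Rightarrow> real) \<Rightarrow> 'a \<Rightarrow> 'a \<times> real \<Rightarrow> bool" where
  "unique_minimizer g y p \<longleftrightarrow> minimizer g y p \<and> (\<forall>z. minimizer g z p \<longrightarrow> z = y)"

definition char_pos :: "('a::euclidean_space \<Rightarrow> real) \<Rightarrow> 'a \<Rightarrow> real \<Rightarrow> 'a" where
  "char_pos g y0 t = y0 + t *\<^sub>R (grad g y0 /\<^sub>R norm (grad g y0))"

text \<open>
  The times below live in \<open>[0, \<infinity>]\<close>, i.e. in \<^typ>\<open>ennreal\<close>, where the supremum of the
  empty set is \<open>0\<close> and its infimum is \<open>\<infinity>\<close>.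
\<close>

definition ts_bar :: "('a::euclidean_space \<Rightarrow> real) \<Rightarrow> 'a \<Rightarrow> ennreal" where
  "ts_bar g y0 = Sup {ennreal t | t. 0 < t \<and> unique_minimizer g y0 (char_pos g y0 t, t)}"

definition ts :: "('a::euclidean_space \<Rightarrow> real) \<Rightarrow> 'a \<Rightarrow> ennreal" where
  "ts g y0 = Inf {ennreal t | t. 0 < t \<and> \<not> minimizer g y0 (char_pos g y0 t, t)}"

definition M_set :: "('a::euclidean_space \<Rightarrow> real) \<Rightarrow> 'a set" where
  "M_set g = {y0. grad g y0 \<noteq> 0 \<and> ts_bar g y0 < \<infinity>}"

text \<open>
  Since \<open>t\<close> is real, \<open>ennreal t \<le> ts g y0\<close> covers both \<open>ts g y0 < \<infinity>\<close> (closed interval)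
  and \<open>ts g y0 = \<infinity>\<close> (half-line). The guard \<open>0 \<le> t\<close> is needed because \<open>ennreal\<close> sends
  negative reals to \<open>0\<close>. The same remarks apply to \<open>P0_set\<close>.
\<close>

definition TM_set :: "('a::euclidean_space \<Rightarrow> real) \<Rightarrow> ('a \<times> real) set" where
  "TM_set g = {(char_pos g y0 t, t) | y0 t.
     y0 \<in> M_set g \<and> 0 \<le> t \<and> ts_bar g y0 \<le> ennreal t \<and> ennreal t \<le> ts g y0}"

definition T1_set :: "('a::euclidean_space \<Rightarrow> real) \<Rightarrow> ('a \<times> real) set" where
  "T1_set g = {p \<in> TM_set g. \<exists>y. unique_minimizer g y p}"

definition ts_crit :: "('a::euclidean_space \<Rightarrow> real) \<Rightarrow> 'a \<Rightarrow> 'a \<Rightarrow> ennreal" where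
  "ts_crit g y0 P = Inf {ennreal t | t. 0 < t \<and> \<not> minimizer g y0 (y0 + t *\<^sub>R P, t)}"

definition P0_set :: "('a::euclidean_space \<Rightarrow> real) \<Rightarrow> ('a \<times> real) set" where
  "P0_set g = {(y0 + t *\<^sub>R P, t) | y0 P t.
     grad g y0 = 0 \<and> norm P = 1 \<and> 0 \<le> t \<and> ennreal t \<le> ts_crit g y0 P}"

definition Sigma_set :: "('a::euclidean_space \<Rightarrow> real) \<Rightarrow> ('a \<times> real) set" where
  "Sigma_set g = {p. 0 < snd p \<and> \<not> hopf_lax g differentiable (at p)}"

end

theory Submission
  imports Defs
begin

text \<open>
  Differentiability of \<open>u = hopf_lax g\<close> at \<open>(x, t)\<close> determines the gradient of \<open>g\<close> at every
  minimizer. Indeed, if \<open>y\<close> is a minimizer and \<open>e = (x - y)/t\<close>, then \<open>|e| \<le> 1\<close>, so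
  \<open>u(x + h, t + \<tau>) \<le> g(y + h - \<tau>e)\<close> with equality at \<open>(h, \<tau>) = 0\<close>; two differentiable functions that
  touch have the same derivative, hence \<open>Du(x, t)(h, \<tau>) = Dg(y) \<bullet> (h - \<tau>e)\<close>
  (\<open>hopf_lax_derivative\<close>). All minimizers therefore share one gradient, and there are two cases.

  Suppose first that this gradient is not zero. A minimizer with non-zero gradient lies on the sphere
  and \<open>x\<close> is the point at time \<open>t\<close> of its characteristic (\<open>minimizer_on_characteristic\<close>). As the
  gradients agree, the minimizer \<open>y\<^sub>0\<close> is unique. Then \<open>t \<le> t\<^sub>s(y\<^sub>0)\<close>, and
  \<open>(x, t)\<close> lies outside \<open>T\<^sub>1\<close>, so \<open>y\<^sub>0\<close> is still a minimizer at some later time \<open>r > t\<close> of its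
  characteristic. The second-order condition for the minimum over the ball of radius \<open>r\<close> bounds the
  tangential Hessian of \<open>g\<close> from below by \<open>-|Dg(y\<^sub>0)|/r\<close>, which is strictly better than the bound
  \<open>-|Dg(y\<^sub>0)|/t\<close> at which the map \<open>y \<mapsto> X(y, t)\<close> degenerates (\<open>characteristic_flow_injective\<close>). The
  inverse function theorem gives a foot map \<open>Y\<close> of class \<open>C\<^sup>k\<^sup>-\<^sup>1\<close> with \<open>Y(X(y, s), s) = y\<close>
  (\<open>characteristic_flow_inverse\<close>). By compactness, minimizers for points near \<open>(x, t)\<close> are near \<open>y\<^sub>0\<close>
  (\<open>minimizers_nearby\<close>), so they are given by \<open>Y\<close> and \<open>u = g \<circ> Y\<close>. This only shows that \<open>u\<close> is of
  class \<open>C\<^sup>k\<^sup>-\<^sup>1\<close>; the missing derivative comes from \<open>hopf_lax_derivative\<close>, by which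
  \<open>Du = (Dg(Y), -|Dg(Y)|)\<close> is of class \<open>C\<^sup>k\<^sup>-\<^sup>1\<close> as well.

  Suppose now that \<open>Dg\<close> vanishes at all minimizers. A minimizer on the sphere would put \<open>(x, t)\<close> in
  \<open>P\<^sup>0\<close>, so all minimizers lie in the open ball. The same compactness argument then shows that \<open>u\<close> is
  constant near \<open>(x, t)\<close> (\<open>hopf_lax_locally_constant\<close>).
\<close>

section \<open>Calculus of \<open>C\<^sup>k\<close> functions\<close>

lemma Ck_on_subset: "Ck_on k f S \<Longrightarrow> T \<subseteq> S \<Longrightarrow> Ck_on k f T"
  by (induction k arbitrary: f) (auto intro: continuous_on_subset)

lemma Ck_on_frechet_derivative:
  "Ck_on (Suc k) f S \<Longrightarrow> Ck_on k (\<lambda>x. frechet_derivative f (at x) v) S"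
  unfolding Ck_on.simps by (elim conjE allE)

lemma Ck_on_SucD: "Ck_on (Suc k) f S \<Longrightarrow> Ck_on k f S"
proof (induction k arbitrary: f)
  case 0
  then show ?case
    by (auto intro!: continuous_at_imp_continuous_on differentiable_imp_continuous_within)
next
  case (Suc k)
  show ?case
    unfolding Ck_on.simps(2)[of k]
  proof (intro conjI allI)
    show "\<forall>x\<in>S. f differentiable at x"
      using Suc.prems by simp
    show "Ck_on k (\<lambda>x. frechet_derivative f (at x) v) S" for v
      by (rule Suc.IH[OF Ck_on_frechet_derivative[OF Suc.prems]])
  qed
qed

lemma Ck_on_mono: "Ck_on k f S \<Longrightarrow> j \<le> k \<Longrightarrow> Ck_on j f S"
  by (induction k) (auto simp: le_Suc_eq simp del: Ck_on.simps dest: Ck_on_SucD)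

lemma Ck_on_imp_continuous_on: "Ck_on k f S \<Longrightarrow> continuous_on S f"
  using Ck_on_mono[of k f S 0] by simp

lemma Ck_on_cong:
  assumes "open S" "\<And>x. x \<in> S \<Longrightarrow> f x = g x" "Ck_on k f S"
  shows "Ck_on k g S"
  using assms(2,3)
proof (induction k arbitrary: f g)
  case 0
  then show ?case
    using continuous_on_cong[of S S f g] by simp
next
  case (Suc k)
  have D: "(g has_derivative frechet_derivative f (at x)) (at x)" if "x \<in> S" for x
    using Suc.prems that assms(1)
    by (auto intro!: has_derivative_transform_within_open[of f _ x UNIV S g]
        simp: frechet_derivative_works[symmetric])
  have eq: "frechet_derivative f (at x) v = frechet_derivative g (at x) v" if "x \<in> S" for x v
    using frechet_derivative_at[OF D[OF that]] by simp
  have "Ck_on k (\<lambda>x. frechet_derivative g (at x) v) S" for v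
    by (rule Suc.IH[OF eq Ck_on_frechet_derivative[OF Suc.prems(2)]])
  then show ?case
    using D unfolding Ck_on.simps differentiable_def by blast
qed

text \<open>
Any pointwise derivative may be used in place of \<open>frechet_derivative\<close>; the
inductions on \<open>k\<close> below rest on this.
\<close>

lemma Ck_on_SucI:
  assumes "open S" "\<And>x. x \<in> S \<Longrightarrow> (f has_derivative f' x) (at x)"
    and "\<And>v. Ck_on k (\<lambda>x. f' x v) S"
  shows "Ck_on (Suc k) f S"
proof -
  have "f' x = frechet_derivative f (at x)" if "x \<in> S" for x
    using frechet_derivative_at assms(2)[OF that] by blast
  then have "Ck_on k (\<lambda>x. frechet_derivative f (at x) v) S" for v
    by (intro Ck_on_cong[OF assms(1) _ assms(3)[of v]]) simp
  then show ?thesis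
    using assms(2) unfolding Ck_on.simps differentiable_def by blast
qed

lemma Ck_on_Suc_has_derivative:
  "Ck_on (Suc k) f S \<Longrightarrow> x \<in> S \<Longrightarrow> (f has_derivative frechet_derivative f (at x)) (at x)"
  by (simp add: frechet_derivative_works)

lemma Ck_on_const: "open S \<Longrightarrow> Ck_on k (\<lambda>x. c) S"
proof (induction k arbitrary: c)
  case (Suc k)
  show ?case
    by (rule Ck_on_SucI[where f' = "\<lambda>x v. 0"]) (use Suc in auto)
qed auto

lemma Ck_on_bounded_linear:
  assumes "bounded_linear L" "open S" "Ck_on k f S"
  shows "Ck_on k (\<lambda>x. L (f x)) S"
  using assms(3)
proof (induction k arbitrary: f)
  case 0
  then show ?case
    using bounded_linear.continuous_on[OF assms(1)] by simp
next
  case (Suc k)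
  show ?case
  proof (rule Ck_on_SucI[OF assms(2)])
    show "((\<lambda>x. L (f x)) has_derivative (\<lambda>v. L (frechet_derivative f (at x) v))) (at x)"
      if "x \<in> S" for x
      by (rule bounded_linear.has_derivative[OF assms(1) Ck_on_Suc_has_derivative[OF Suc.prems that]])
    show "Ck_on k (\<lambda>x. L (frechet_derivative f (at x) v)) S" for v
      by (rule Suc.IH[OF Ck_on_frechet_derivative[OF Suc.prems]])
  qed
qed

lemma Ck_on_id: "open S \<Longrightarrow> Ck_on k (\<lambda>x. x) S"
proof (cases k)
  case (Suc j)
  assume "open S"
  then show ?thesis
    unfolding Suc by (intro Ck_on_SucI[where f' = "\<lambda>x v. v"]) (auto intro: Ck_on_const)
qed auto

lemma Ck_on_linear: "bounded_linear L \<Longrightarrow> open S \<Longrightarrow> Ck_on k L S"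
  using Ck_on_bounded_linear[of L S k "\<lambda>x. x"] Ck_on_id by blast

lemma Ck_on_add:
  assumes "open S" "Ck_on k f S" "Ck_on k g S"
  shows "Ck_on k (\<lambda>x. f x + g x) S"
  using assms(2,3)
proof (induction k arbitrary: f g)
  case (Suc k)
  show ?case
    by (rule Ck_on_SucI[OF assms(1) has_derivative_add])
      (rule Suc.IH Suc.prems[THEN Ck_on_frechet_derivative] Suc.prems[THEN Ck_on_Suc_has_derivative]
        | assumption)+
qed (auto intro: continuous_on_add)

lemma Ck_on_bilinear:
  assumes "bounded_bilinear pr" "open S" "Ck_on k f S" "Ck_on k g S"
  shows "Ck_on k (\<lambda>x. pr (f x) (g x)) S"
  using assms(3,4)
proof (induction k arbitrary: f g)
  case 0
  then show ?case
    using bounded_bilinear.continuous_on[OF assms(1)] by simp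
next
  case (Suc k)
  show ?case
  proof (rule Ck_on_SucI[OF assms(2)])
    show "((\<lambda>x. pr (f x) (g x)) has_derivative
       (\<lambda>v. pr (f x) (frechet_derivative g (at x) v) + pr (frechet_derivative f (at x) v) (g x))) (at x)"
      if "x \<in> S" for x
      by (intro bounded_bilinear.FDERIV[OF assms(1)] Ck_on_Suc_has_derivative[OF Suc.prems(1) that]
          Ck_on_Suc_has_derivative[OF Suc.prems(2) that])
    show "Ck_on k (\<lambda>x. pr (f x) (frechet_derivative g (at x) v)
        + pr (frechet_derivative f (at x) v) (g x)) S" for v
      by (intro Ck_on_add assms(2) Suc.IH Ck_on_frechet_derivative[OF Suc.prems(1)]
          Ck_on_frechet_derivative[OF Suc.prems(2)] Suc.prems[THEN Ck_on_SucD])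
  qed
qed

lemmas Ck_on_scaleR = Ck_on_bilinear[OF bounded_bilinear_scaleR]
  and Ck_on_mult = Ck_on_bilinear[OF bounded_bilinear_mult]
  and Ck_on_inner = Ck_on_bilinear[OF bounded_bilinear_inner]

lemma Ck_on_diff:
  assumes "open S" "Ck_on k f S" "Ck_on k g S"
  shows "Ck_on k (\<lambda>x. f x - g x) S"
  using Ck_on_add[OF assms(1,2) Ck_on_bounded_linear[OF bounded_linear_minus[OF bounded_linear_ident] assms(1,3)]]
  by simp

lemma Ck_on_sum:
  assumes "open S" "\<And>i. i \<in> I \<Longrightarrow> Ck_on k (f i) S"
  shows "Ck_on k (\<lambda>x. \<Sum>i\<in>I. f i x) S"
  using assms(2)
  by (induction I rule: infinite_finite_induct) (auto intro!: Ck_on_add Ck_on_const assms(1))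

lemma Ck_on_prod:
  fixes f :: "'i \<Rightarrow> 'a::real_normed_vector \<Rightarrow> real"
  assumes "open S" "\<And>i. i \<in> I \<Longrightarrow> Ck_on k (f i) S"
  shows "Ck_on k (\<lambda>x. \<Prod>i\<in>I. f i x) S"
  using assms(2)
  by (induction I rule: infinite_finite_induct) (auto intro!: Ck_on_mult Ck_on_const assms(1))

lemma linear_basis_expansion:
  fixes L :: "'a::euclidean_space \<Rightarrow> 'b::real_vector"
  assumes "linear L"
  shows "L v = (\<Sum>b\<in>Basis. (v \<bullet> b) *\<^sub>R L b)"
proof -
  have "L v = L (\<Sum>b\<in>Basis. (v \<bullet> b) *\<^sub>R b)"
    by (simp add: euclidean_representation)
  then show ?thesis
    by (simp add: linear_sum[OF assms] linear_scale[OF assms])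
qed

text \<open>
By the chain rule the derivative of \<open>f \<circ> g\<close> in direction \<open>v\<close> is \<open>Df(g x)(Dg(x) v)\<close>, whose direction
\<open>Dg(x) v\<close> varies with \<open>x\<close>. Expanding it in an orthonormal basis of the finite-dimensional middle space
leaves only directional derivatives of \<open>f\<close> in fixed directions, to which the induction applies.
\<close>

lemma Ck_on_compose:
  fixes f :: "'b::euclidean_space \<Rightarrow> 'c::real_normed_vector"
    and g :: "'a::real_normed_vector \<Rightarrow> 'b"
  assumes "open S" "Ck_on k f T" "Ck_on k g S" "g ` S \<subseteq> T"
  shows "Ck_on k (\<lambda>x. f (g x)) S"
  using assms(2,3)
proof (induction k arbitrary: f)
  case 0
  then show ?case
    using continuous_on_compose2 assms(4) by fastforce
next
  case (Suc k)
  let ?f' = "\<lambda>y. frechet_derivative f (at y)" and ?g' = "\<lambda>x. frechet_derivative g (at x)"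
  show ?case
  proof (rule Ck_on_SucI[OF assms(1)])
    fix x assume x: "x \<in> S"
    have f': "(f has_derivative ?f' (g x)) (at (g x))"
      using x assms(4) by (intro Ck_on_Suc_has_derivative[OF Suc.prems(1)]) blast
    have "((\<lambda>x. f (g x)) has_derivative (\<lambda>v. ?f' (g x) (?g' x v))) (at x)"
      by (rule has_derivative_compose[OF Ck_on_Suc_has_derivative[OF Suc.prems(2) x] f'])
    also have "(\<lambda>v. ?f' (g x) (?g' x v)) = (\<lambda>v. \<Sum>b\<in>Basis. (?g' x v \<bullet> b) *\<^sub>R ?f' (g x) b)"
      by (rule ext) (rule linear_basis_expansion[OF has_derivative_linear[OF f']])
    finally show "((\<lambda>x. f (g x)) has_derivative
      (\<lambda>v. \<Sum>b\<in>Basis. (?g' x v \<bullet> b) *\<^sub>R ?f' (g x) b)) (at x)" .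
  next
    fix v
    have "Ck_on k (\<lambda>x. ?f' (g x) b) S" for b
      by (rule Suc.IH[OF Ck_on_frechet_derivative[OF Suc.prems(1)] Ck_on_SucD[OF Suc.prems(2)]])
    then show "Ck_on k (\<lambda>x. \<Sum>b\<in>Basis. (?g' x v \<bullet> b) *\<^sub>R ?f' (g x) b) S"
      by (intro Ck_on_sum Ck_on_scaleR Ck_on_inner Ck_on_const assms(1)
          Ck_on_frechet_derivative[OF Suc.prems(2)])
  qed
qed

lemma Ck_on_inverse:
  fixes f :: "'a::real_normed_vector \<Rightarrow> real"
  assumes "open S" "Ck_on k f S" "\<And>x. x \<in> S \<Longrightarrow> f x \<noteq> 0"
  shows "Ck_on k (\<lambda>x. inverse (f x)) S"
  using assms(2)
proof (induction k)
  case 0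
  then show ?case
    using assms(3) by (auto intro: continuous_on_inverse)
next
  case (Suc k)
  show ?case
  proof (rule Ck_on_SucI[OF assms(1)])
    show "((\<lambda>x. inverse (f x)) has_derivative
      (\<lambda>v. - (inverse (f x) * frechet_derivative f (at x) v * inverse (f x)))) (at x)" if "x \<in> S" for x
      by (rule Deriv.has_derivative_inverse[OF assms(3)[OF that] Ck_on_Suc_has_derivative[OF Suc.prems that]])
    show "Ck_on k (\<lambda>x. - (inverse (f x) * frechet_derivative f (at x) v * inverse (f x))) S" for v
      by (intro Ck_on_bounded_linear[OF bounded_linear_minus[OF bounded_linear_ident]] Ck_on_mult
          assms(1) Suc.IH Ck_on_frechet_derivative[OF Suc.prems] Ck_on_SucD[OF Suc.prems])
  qed
qed

lemma Ck_on_sqrt: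
  fixes f :: "'a::real_normed_vector \<Rightarrow> real"
  assumes "open S" "Ck_on k f S" "\<And>x. x \<in> S \<Longrightarrow> f x > 0"
  shows "Ck_on k (\<lambda>x. sqrt (f x)) S"
  using assms(2)
proof (induction k)
  case 0
  then show ?case
    by (auto intro: continuous_on_real_sqrt)
next
  case (Suc k)
  show ?case
  proof (rule Ck_on_SucI[OF assms(1)])
    show "((\<lambda>x. sqrt (f x)) has_derivative
      (\<lambda>v. frechet_derivative f (at x) v * (inverse (sqrt (f x)) * (1/2)))) (at x)" if "x \<in> S" for x
      by (rule has_derivative_eq_rhs[OF has_derivative_real_sqrt[OF assms(3)[OF that]
              Ck_on_Suc_has_derivative[OF Suc.prems that]]])
         (simp add: field_simps)
    have "Ck_on k (\<lambda>x. inverse (sqrt (f x))) S"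
      using assms(3) by (intro Ck_on_inverse assms(1) Suc.IH Ck_on_SucD[OF Suc.prems]) force
    then show "Ck_on k (\<lambda>x. frechet_derivative f (at x) v * (inverse (sqrt (f x)) * (1/2))) S" for v
      by (intro Ck_on_mult Ck_on_const assms(1) Ck_on_frechet_derivative[OF Suc.prems])
  qed
qed

lemma Ck_on_norm:
  fixes f :: "'a::real_normed_vector \<Rightarrow> 'b::real_inner"
  assumes "open S" "Ck_on k f S" "\<And>x. x \<in> S \<Longrightarrow> f x \<noteq> 0"
  shows "Ck_on k (\<lambda>x. norm (f x)) S"
  unfolding norm_eq_sqrt_inner
  by (intro Ck_on_sqrt Ck_on_inner assms(1,2)) (use assms(3) in auto)

lemma Ck_on_vec_lambda:
  fixes f :: "'a::real_normed_vector \<Rightarrow> 'n::finite \<Rightarrow> real"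
  assumes "open S" "\<And>i. Ck_on k (\<lambda>x. f x i) S"
  shows "Ck_on k (\<lambda>x. \<chi> i. f x i) S"
proof -
  have "(\<chi> i. f x i) = (\<Sum>i\<in>UNIV. f x i *\<^sub>R axis i 1)" for x
    by (simp add: vec_eq_iff axis_def if_distrib sum.delta cong: if_cong)
  then show ?thesis
    by (simp only:) (intro Ck_on_sum Ck_on_scaleR Ck_on_const assms)
qed

lemma Ck_on_det:
  fixes A :: "'a::real_normed_vector \<Rightarrow> real^'n^'n"
  assumes "open S" "\<And>i j. Ck_on k (\<lambda>x. A x $ i $ j) S"
  shows "Ck_on k (\<lambda>x. det (A x)) S"
  unfolding det_def by (intro Ck_on_sum Ck_on_mult Ck_on_prod Ck_on_const assms)

text \<open>
Cramer's rule writes \<open>w\<close> as a quotient of polynomials in the entries of \<open>A\<close> and \<open>b\<close>. So the regularity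
of \<open>w\<close> follows from the closure properties above.
\<close>

lemma Ck_on_linear_system_solution:
  fixes A :: "'a::real_normed_vector \<Rightarrow> real^'n^'n" and b w :: "'a \<Rightarrow> real^'n"
  assumes S: "open S"
    and A: "\<And>i j. Ck_on k (\<lambda>x. A x $ i $ j) S"
    and b: "\<And>i. Ck_on k (\<lambda>x. b x $ i) S"
    and nz: "\<And>x. x \<in> S \<Longrightarrow> det (A x) \<noteq> 0"
    and eq: "\<And>x. x \<in> S \<Longrightarrow> A x *v w x = b x"
  shows "Ck_on k w S"
proof -
  have sol: "(\<chi> i. det (\<chi> r c. if c = i then b x $ r else A x $ r $ c) * inverse (det (A x))) = w x"
    if "x \<in> S" for x
    using cramer[OF nz[OF that], of "w x" "b x"] eq[OF that] by (simp add: divide_inverse)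
  have "Ck_on k (\<lambda>x. (\<chi> r c. if c = i then b x $ r else A x $ r $ c) $ p $ q) S" for i p q
    using A b by (cases "q = i") auto
  then have "Ck_on k (\<lambda>x. \<chi> i. det (\<chi> r c. if c = i then b x $ r else A x $ r $ c)
      * inverse (det (A x))) S"
    by (intro Ck_on_vec_lambda Ck_on_mult Ck_on_inverse Ck_on_det S A nz)
  from Ck_on_cong[OF S sol this] show ?thesis .
qed

section \<open>The gradient\<close>

lemma
  fixes g :: "'a::euclidean_space \<Rightarrow> real"
  assumes "g differentiable at y"
  shows has_derivative_grad: "(g has_derivative (\<lambda>h. grad g y \<bullet> h)) (at y)"
    and grad_eq_sum: "grad g y = (\<Sum>b\<in>Basis. frechet_derivative g (at y) b *\<^sub>R b)"
proof -
  let ?D = "\<Sum>b\<in>Basis. frechet_derivative g (at y) b *\<^sub>R b"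
  have g': "(g has_derivative frechet_derivative g (at y)) (at y)"
    using assms by (simp add: frechet_derivative_works)
  have eq: "frechet_derivative g (at y) = (\<lambda>h. h \<bullet> ?D)"
    by (rule ext, subst linear_basis_expansion[OF has_derivative_linear[OF g']]) (simp add: inner_sum_right mult.commute)
  have D: "GDERIV g y :> ?D"
    unfolding gderiv_def by (rule has_derivative_eq_rhs[OF g' eq])
  have "E = ?D" if "GDERIV g y :> E" for E
  proof -
    have "(\<lambda>h. h \<bullet> E) = (\<lambda>h. h \<bullet> ?D)"
      using that D unfolding gderiv_def by (rule has_derivative_unique)
    from fun_cong[OF this] show ?thesis
      by (intro vector_eq_ldot[THEN iffD1]) blast
  qed
  with D show eq: "grad g y = ?D"
    unfolding grad_def by (rule the_equality)
  show "(g has_derivative (\<lambda>h. grad g y \<bullet> h)) (at y)"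
    using D unfolding eq gderiv_def by (simp only: inner_commute)
qed

lemma Ck_on_grad:
  fixes g :: "'a::euclidean_space \<Rightarrow> real"
  assumes "Ck_on (Suc k) g UNIV"
  shows "Ck_on k (grad g) UNIV"
proof -
  have "Ck_on k (\<lambda>y. \<Sum>b\<in>Basis. frechet_derivative g (at y) b *\<^sub>R b) UNIV"
    by (intro Ck_on_sum Ck_on_scaleR Ck_on_const Ck_on_frechet_derivative[OF assms] open_UNIV)
  moreover have "g differentiable at y" for y
    using Ck_on_Suc_has_derivative[OF assms UNIV_I] unfolding differentiable_def by blast
  ultimately show ?thesis
    by (simp only: grad_eq_sum[symmetric])
qed

text \<open>
For \<open>Dg(y) \<noteq> 0\<close>, \<open>sgn (grad g y)\<close> is the direction in which the characteristic leaves \<open>y\<close>.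
\<close>

lemma Ck_on_sgn_grad:
  fixes g :: "'a::euclidean_space \<Rightarrow> real"
  assumes "Ck_on (Suc k) g UNIV" "open S" "\<And>y. y \<in> S \<Longrightarrow> grad g y \<noteq> 0"
  shows "Ck_on k (\<lambda>y. sgn (grad g y)) S"
  unfolding sgn_div_norm
  by (intro Ck_on_scaleR Ck_on_inverse Ck_on_norm assms(2)
      Ck_on_subset[OF Ck_on_grad[OF assms(1)] subset_UNIV]) (use assms(3) in simp_all)

section \<open>Minimizers and characteristics\<close>

lemma minimizer_iff:
  assumes "continuous_on UNIV g"
  shows "minimizer g y (x, t) \<longleftrightarrow> y \<in> cball x t \<and> (\<forall>z\<in>cball x t. g y \<le> g z)"
proof (cases "norm (y - x) \<le> t")
  case True
  then have "0 \<le> t"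
    using norm_ge_zero order_trans by blast
  then obtain y1 where "norm (x - y1) \<le> t" "hopf_lax g (x, t) = g y1"
      "\<forall>z. norm (x - z) \<le> t \<longrightarrow> g y1 \<le> g z"
    using hopf_lax_is_min[OF assms] by blast
  with True show ?thesis
    by (auto simp: minimizer_def dist_norm norm_minus_commute intro: order_antisym)
qed (auto simp: minimizer_def dist_norm norm_minus_commute)

lemma minimizer_exists:
  assumes "continuous_on UNIV g" "0 \<le> t"
  shows "\<exists>y. minimizer g y (x, t)"
  using hopf_lax_is_min[OF assms, of x] by (auto simp: minimizer_def norm_minus_commute)

lemma hopf_lax_eq: "minimizer g y p \<Longrightarrow> hopf_lax g p = g y"
  by (auto simp: minimizer_def split: prod.splits)

lemma hopf_lax_le:
  assumes "continuous_on UNIV g" "z \<in> cball x t"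
  shows "hopf_lax g (x, t) \<le> g z"
proof -
  have "0 \<le> t"
    using assms(2) by (metis dist_not_less_zero mem_cball not_le order_le_less_trans)
  then obtain y where "minimizer g y (x, t)"
    using minimizer_exists[OF assms(1)] by blast
  then show ?thesis
    using assms by (simp add: hopf_lax_eq minimizer_iff)
qed

text \<open>
The balls \<open>cball (y + s P) s\<close> increase with \<open>s\<close>, because their centres move with speed at most \<open>1\<close>.
\<close>

lemma minimizer_backwards:
  assumes "continuous_on UNIV g" "norm P \<le> 1" "0 \<le> s" "s \<le> t"
    and "minimizer g y (y + t *\<^sub>R P, t)"
  shows "minimizer g y (y + s *\<^sub>R P, s)"
proof -
  have "dist (y + s *\<^sub>R P) (y + t *\<^sub>R P) = (t - s) * norm P"
    using assms(4) by (simp add: dist_norm norm_minus_commute flip: scaleR_diff_left)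
  also have "\<dots> \<le> t - s"
    using assms by (intro mult_left_le) auto
  finally have "cball (y + s *\<^sub>R P) s \<subseteq> cball (y + t *\<^sub>R P) t"
    by (simp add: cball_subset_cball_iff)
  moreover have "y \<in> cball (y + s *\<^sub>R P) s"
    using assms by (simp add: dist_norm mult_left_le)
  ultimately show ?thesis
    using assms(5) unfolding minimizer_iff[OF assms(1)] by blast
qed

lemma char_pos_eq_sgn: "char_pos g y t = y + t *\<^sub>R sgn (grad g y)"
  by (simp add: char_pos_def sgn_div_norm)

lemma minimizer_first_variation:
  assumes g: "continuous_on UNIV g" "g differentiable at y"
    and y: "minimizer g y (x, t)" and z: "z \<in> cball x t"
  shows "0 \<le> grad g y \<bullet> (z - y)"
proof (rule ccontr)
  let ?c = "\<lambda>s::real. y + s *\<^sub>R (z - y)"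
  assume "\<not> 0 \<le> grad g y \<bullet> (z - y)"
  moreover have "((\<lambda>s. g (?c s)) has_derivative (\<lambda>h. grad g y \<bullet> (h *\<^sub>R (z - y)))) (at 0)"
    by (rule has_derivative_compose[of ?c])
      (auto intro!: derivative_eq_intros has_derivative_grad g(2))
  then have "((\<lambda>s. g (?c s)) has_real_derivative grad g y \<bullet> (z - y)) (at 0)"
    by (simp add: has_field_derivative_def mult_commute_abs)
  ultimately obtain d where d: "d > 0" "\<And>h. 0 < h \<Longrightarrow> h < d \<Longrightarrow> g (?c h) < g y"
    using DERIV_neg_dec_right[of "\<lambda>s. g (?c s)" _ 0] by force
  define h where "h = min 1 (d / 2)"
  have h: "0 < h" "h < d" "h \<le> 1"
    using d(1) by (auto simp: h_def)
  have "(1 - h) *\<^sub>R y + h *\<^sub>R z \<in> cball x t"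
    using h y z by (intro convexD[OF convex_cball]) (auto simp: minimizer_iff[OF g(1)])
  then have "?c h \<in> cball x t"
    by (simp add: algebra_simps)
  then show False
    using d(2)[OF h(1,2)] y by (force simp: minimizer_iff[OF g(1)])
qed

text \<open>
The first variation is tested with the point \<open>z = x - t Dg(y)/|Dg(y)|\<close> of the ball, the one in which the
linearization of \<open>g\<close> is smallest. Cauchy--Schwarz, with its equality case, forces \<open>y = z\<close>.
\<close>

lemma minimizer_on_characteristic:
  assumes g: "continuous_on UNIV g" "g differentiable at y" "grad g y \<noteq> 0"
    and y: "minimizer g y (x, t)"
  shows "x = char_pos g y t"
proof -
  let ?nu = "sgn (grad g y)"
  have t: "norm (x - y) \<le> t"
    using y by (simp add: minimizer_def norm_minus_commute)
  have t0: "0 \<le> t"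
    using norm_ge_zero t by (rule order_trans)
  have nu: "norm ?nu = 1"
    using g(3) by (simp add: norm_sgn)
  have "x - t *\<^sub>R ?nu \<in> cball x t"
    using t0 nu by (simp add: dist_norm)
  from minimizer_first_variation[OF g(1,2) y this]
  have "0 \<le> grad g y \<bullet> (x - y - t *\<^sub>R ?nu)"
    by (simp add: algebra_simps)
  moreover have "grad g y \<bullet> w = norm (grad g y) * (?nu \<bullet> w)" for w
    using g(3) by (simp add: sgn_div_norm)
  ultimately have "0 \<le> ?nu \<bullet> (x - y - t *\<^sub>R ?nu)"
    using g(3) by (simp add: zero_le_mult_iff)
  then have "t \<le> ?nu \<bullet> (x - y)"
    using nu by (simp add: inner_diff_right dot_square_norm)
  then have "t * t \<le> t * (?nu \<bullet> (x - y))"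
    using t0 by (rule mult_left_mono)
  moreover have "(norm (w - t *\<^sub>R ?nu))\<^sup>2 = (norm w)\<^sup>2 - 2 * (t * (?nu \<bullet> w)) + t * t * (?nu \<bullet> ?nu)" for w
    by (simp add: power2_norm_eq_inner inner_diff inner_commute algebra_simps)
  then have "(norm (x - y - t *\<^sub>R ?nu))\<^sup>2 = (norm (x - y))\<^sup>2 - 2 * (t * (?nu \<bullet> (x - y))) + t * t"
    using nu by (simp add: dot_square_norm)
  moreover have "(norm (x - y))\<^sup>2 \<le> t * t"
    using t t0 by (simp add: power2_eq_square mult_mono)
  ultimately have "(norm (x - y - t *\<^sub>R ?nu))\<^sup>2 \<le> 0"
    by linarith
  then show ?thesis
    by (simp add: char_pos_eq_sgn algebra_simps)
qed

text \<open>
Translating \<open>y\<close> by \<open>h - \<tau>e\<close> with \<open>e = (x - y)/t\<close> keeps it in the ball of radius \<open>t + \<tau>\<close> around \<open>x + h\<close>,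
since the difference of the centre and the translated point is \<open>(t + \<tau>)e\<close>. Thus \<open>u\<close> is touched from above at \<open>(x, t)\<close> by a
function with the asserted derivative.
\<close>

lemma hopf_lax_derivative:
  assumes g: "continuous_on UNIV g" "g differentiable at y"
    and y: "minimizer g y (x, t)" and t: "0 < t"
    and u: "hopf_lax g differentiable at (x, t)"
  shows "(hopf_lax g has_derivative
    (\<lambda>q. grad g y \<bullet> (fst q - snd q *\<^sub>R ((x - y) /\<^sub>R t)))) (at (x, t))"
proof -
  let ?e = "(x - y) /\<^sub>R t"
  let ?c = "\<lambda>p. y + (fst p - x) - (snd p - t) *\<^sub>R ?e"
  let ?u' = "frechet_derivative (hopf_lax g) (at (x, t))"
  have u': "(hopf_lax g has_derivative ?u') (at (x, t))"
    using u by (simp add: frechet_derivative_works)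
  have gc: "((\<lambda>p. g (?c p)) has_derivative (\<lambda>q. grad g y \<bullet> (fst q - snd q *\<^sub>R ?e))) (at (x, t))"
    by (rule has_derivative_compose[of ?c])
      (auto intro!: derivative_eq_intros has_derivative_grad g(2))
  have le: "hopf_lax g p \<le> g (?c p)" if "p \<in> UNIV \<times> {0<..}" for p
  proof -
    obtain x' s where "p = (x', s)"
      by (cases p)
    with that have p: "p = (x', s)" "0 < s"
      by auto
    have xy: "x - y = t *\<^sub>R ?e"
      using t by simp
    have "x' - ?c p = (x - y) + (s - t) *\<^sub>R ?e"
      by (simp add: p(1))
    also have "\<dots> = t *\<^sub>R ?e + (s - t) *\<^sub>R ?e"
      by (subst xy) (rule refl)
    also have "\<dots> = s *\<^sub>R ?e"
      by (simp only: scaleR_add_left[symmetric] add_diff_cancel_left' diff_add_cancel add.commute[of t])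
    finally have "dist x' (?c p) = norm (s *\<^sub>R ?e)"
      by (simp only: dist_norm)
    also have "\<dots> = s * norm ?e"
      using p(2) by (simp only: norm_scaleR abs_of_pos)
    finally have dist: "dist x' (?c p) = s * norm ?e" .
    have "norm ?e \<le> 1"
      using y t by (simp add: minimizer_def norm_minus_commute inverse_eq_divide)
    then have "s * norm ?e \<le> s * 1"
      by (rule mult_left_mono) (use p(2) in simp)
    then show ?thesis
      using hopf_lax_le[OF g(1), of "?c p" x' s] dist by (simp add: p(1))
  qed
  have "(\<lambda>q. grad g y \<bullet> (fst q - snd q *\<^sub>R ?e) - ?u' q) = (\<lambda>q. 0)"
  proof (rule differential_zero_maxmin[OF _ _ has_derivative_diff[OF gc u']])
    show "open (UNIV \<times> {0::real<..})"
      by (intro open_Times open_UNIV open_greaterThan)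
    show "(x, t) \<in> UNIV \<times> {0<..}"
      using t by simp
    have "g (?c (x, t)) - hopf_lax g (x, t) = 0"
      using hopf_lax_eq[OF y] by simp
    then show "(\<forall>p\<in>UNIV \<times> {0<..}. g (?c p) - hopf_lax g p \<le> g (?c (x, t)) - hopf_lax g (x, t)) \<or>
        (\<forall>p\<in>UNIV \<times> {0<..}. g (?c (x, t)) - hopf_lax g (x, t) \<le> g (?c p) - hopf_lax g p)"
      using le by simp
  qed
  then have "?u' = (\<lambda>q. grad g y \<bullet> (fst q - snd q *\<^sub>R ?e))"
    by (simp add: fun_eq_iff)
  with u' show ?thesis
    by simp
qed

lemma minimizers_same_grad:
  assumes g: "continuous_on UNIV g" "g differentiable at y" "g differentiable at z"
    and t: "0 < t" and u: "hopf_lax g differentiable at (x, t)"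
    and y: "minimizer g y (x, t)" and z: "minimizer g z (x, t)"
  shows "grad g y = grad g z"
proof -
  have "(\<lambda>q. grad g y \<bullet> (fst q - snd q *\<^sub>R ((x - y) /\<^sub>R t)))
      = (\<lambda>q. grad g z \<bullet> (fst q - snd q *\<^sub>R ((x - z) /\<^sub>R t)))"
    by (rule has_derivative_unique[OF hopf_lax_derivative[OF g(1,2) y t u]
          hopf_lax_derivative[OF g(1,3) z t u]])
  from fun_cong[OF this, of "(h, 0)" for h] have "grad g y \<bullet> h = grad g z \<bullet> h" for h
    by simp
  then show ?thesis
    by (rule vector_eq_rdot[THEN iffD1, OF allI])
qed

text \<open>
Minimizers depend upper semicontinuously on the point: a limit of minimizers \<open>y\<^sub>n\<close> for points
\<open>(x\<^sub>n, t\<^sub>n) \<longlonglongrightarrow> (x, t)\<close> is a minimizer for \<open>(x, t)\<close>. A sequence of minimizers that avoids the open set \<open>W\<close>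
would by compactness have such a limit outside \<open>W\<close>.
\<close>

lemma minimizers_nearby:
  assumes g: "continuous_on UNIV g" and t: "0 < t" and W: "open W"
    and sub: "\<And>y. minimizer g y (x, t) \<Longrightarrow> y \<in> W"
  shows "\<exists>N. open N \<and> (x, t) \<in> N \<and> N \<subseteq> UNIV \<times> {0<..} \<and> (\<forall>p\<in>N. \<forall>y. minimizer g y p \<longrightarrow> y \<in> W)"
proof (rule ccontr)
  assume contr: "\<not> ?thesis"
  let ?N = "\<lambda>n::nat. ball (x, t) (inverse (Suc n)) \<inter> UNIV \<times> {0<..}"
  have "open (?N n) \<and> (x, t) \<in> ?N n \<and> ?N n \<subseteq> UNIV \<times> {0<..}" for n
    using t by (auto intro!: open_Int open_Times)
  with contr have "\<exists>p y. p \<in> ?N n \<and> minimizer g y p \<and> y \<notin> W" for n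
    by meson
  then obtain p y where py: "\<And>n. p n \<in> ?N n" "\<And>n. minimizer g (y n) (p n)" "\<And>n. y n \<notin> W"
    by metis
  have "(\<lambda>n. dist (p n) (x, t)) \<longlonglongrightarrow> 0"
    by (rule tendsto_sandwich[OF _ _ tendsto_const LIMSEQ_inverse_real_of_nat])
      (use py(1) in \<open>auto intro!: always_eventually less_imp_le simp: dist_commute\<close>)
  then have p: "p \<longlonglongrightarrow> (x, t)"
    by (rule tendsto_dist_iff[THEN iffD2])
  have mem: "y n \<in> cball (fst (p n)) (snd (p n))"
    and min: "z \<in> cball (fst (p n)) (snd (p n)) \<Longrightarrow> g (y n) \<le> g z" for n z
    using py(2)[of n] minimizer_iff[OF g, of "y n" "fst (p n)" "snd (p n)"] by auto
  have "y n \<in> cball x (t + 2)" for n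
  proof -
    have "dist (x, t) (p n) < 1"
      using py(1)[of n] by (auto intro: less_le_trans simp: inverse_eq_divide)
    then have "dist x (fst (p n)) < 1" "dist t (snd (p n)) < 1"
      using dist_fst_le[of "(x, t)" "p n"] dist_snd_le[of "(x, t)" "p n"] by auto
    moreover have "dist (fst (p n)) (y n) \<le> snd (p n)"
      using mem by simp
    ultimately show ?thesis
      using dist_triangle[of x "y n" "fst (p n)"] by (auto simp: dist_real_def)
  qed
  then obtain l r where r: "strict_mono (r::nat \<Rightarrow> nat)" and l: "(y \<circ> r) \<longlonglongrightarrow> l"
    using compact_cball[of x "t + 2"] unfolding compact_def by blast
  have pr: "(\<lambda>n. fst (p (r n))) \<longlonglongrightarrow> x" "(\<lambda>n. snd (p (r n))) \<longlonglongrightarrow> t"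
    using tendsto_fst[OF LIMSEQ_subseq_LIMSEQ[OF p r]] tendsto_snd[OF LIMSEQ_subseq_LIMSEQ[OF p r]]
    by (simp_all add: o_def)
  have yr: "(\<lambda>n. y (r n)) \<longlonglongrightarrow> l"
    using l by (simp add: o_def)
  have g_tendsto: "(\<lambda>n. g (f n)) \<longlonglongrightarrow> g a" if "f \<longlonglongrightarrow> a" for f a
    using g that by (auto intro: continuous_on_tendsto_compose)
  have "l \<notin> W"
  proof
    assume "l \<in> W"
    with yr W have "eventually (\<lambda>n. y (r n) \<in> W) sequentially"
      by (auto dest: topological_tendstoD)
    then show False
      using py(3) by simp
  qed
  moreover have "minimizer g l (x, t)"
    unfolding minimizer_iff[OF g]
  proof (intro conjI ballI)
    show "l \<in> cball x t"
      using tendsto_le[OF _ pr(2) tendsto_dist[OF pr(1) yr]] mem by simp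
    fix z assume z: "z \<in> cball x t"
    \<comment> \<open>The competitor \<open>z\<close> is rescaled into the ball that belongs to \<open>p (r n)\<close>.\<close>
    let ?z = "\<lambda>n. fst (p (r n)) + (snd (p (r n)) / t) *\<^sub>R (z - x)"
    have "g (y (r n)) \<le> g (?z n)" for n
    proof (rule min)
      have "snd (p (r n)) / t > 0"
        using py(1)[of "r n"] t by auto
      moreover have "norm (z - x) \<le> t"
        using z by (simp add: dist_norm norm_minus_commute)
      ultimately have "snd (p (r n)) / t * norm (z - x) \<le> snd (p (r n)) / t * t"
        by (intro mult_left_mono) auto
      then show "?z n \<in> cball (fst (p (r n))) (snd (p (r n)))"
        using py(1)[of "r n"] t by (auto simp: dist_norm)
    qed
    moreover have "?z \<longlonglongrightarrow> x + (t / t) *\<^sub>R (z - x)"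
      using t by (intro tendsto_intros pr) auto
    then have "(\<lambda>n. g (?z n)) \<longlonglongrightarrow> g z"
      using g_tendsto[of ?z "x + (t / t) *\<^sub>R (z - x)"] t by simp
    ultimately show "g l \<le> g z"
      using tendsto_le[OF _ _ g_tendsto[OF yr], of "\<lambda>n. g (?z n)" "g z"] by simp
  qed
  ultimately show False
    using sub by blast
qed

text \<open>
Near \<open>(x, t)\<close> a fixed minimizer \<open>y\<^sub>0\<close> stays admissible, and the minimizers for nearby points stay
in the ball on which \<open>g \<ge> g(y\<^sub>0)\<close>.
\<close>

lemma hopf_lax_locally_constant:
  assumes g: "continuous_on UNIV g" and t: "0 < t"
    and sub: "\<And>y. minimizer g y (x, t) \<Longrightarrow> y \<in> ball x t"
  shows "\<exists>U c. open U \<and> (x, t) \<in> U \<and> U \<subseteq> UNIV \<times> {0<..} \<and> (\<forall>p\<in>U. hopf_lax g p = c)"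
proof -
  have "\<exists>N. open N \<and> (x, t) \<in> N \<and> N \<subseteq> UNIV \<times> {0<..}
      \<and> (\<forall>p\<in>N. \<forall>y. minimizer g y p \<longrightarrow> y \<in> ball x t)"
    by (rule minimizers_nearby[OF g t open_ball]) (rule sub)
  then obtain N where N: "open N" "(x, t) \<in> N" "N \<subseteq> UNIV \<times> {0<..}"
      and near: "\<forall>p\<in>N. \<forall>y. minimizer g y p \<longrightarrow> y \<in> ball x t"
    by (elim exE conjE)
  obtain y0 where y0: "minimizer g y0 (x, t)"
    using minimizer_exists[OF g, of t x] t by auto
  define U where "U = N \<inter> {p. dist (fst p) y0 < snd p}"
  have "hopf_lax g p = g y0" if "p \<in> U" for p
  proof -
    obtain x' s where "p = (x', s)"
      by (cases p)
    with that N(3) have p: "p = (x', s)" "p \<in> N" "dist x' y0 < s" "0 < s"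
      by (auto simp: U_def)
    then obtain y where y: "minimizer g y p"
      using minimizer_exists[OF g, of s x'] by auto
    then have "g y0 \<le> g y"
      using near[rule_format, OF p(2) y] y0 unfolding minimizer_iff[OF g] by (simp add: less_imp_le)
    moreover have "hopf_lax g p \<le> g y0"
      using hopf_lax_le[OF g] p by simp
    ultimately show ?thesis
      using hopf_lax_eq[OF y] by simp
  qed
  moreover have "open U"
    unfolding U_def by (intro open_Int N(1) open_Collect_less continuous_intros)
  moreover have "(x, t) \<in> U"
    using N(2) sub[OF y0] by (simp add: U_def)
  ultimately show ?thesis
    using N(3) by (intro exI[of _ U] exI[of _ "g y0"]) (auto simp: U_def)
qed

text \<open>
If \<open>v\<close> is tangential and \<open>2ra > |v|\<^sup>2\<close>, the curve \<open>s \<mapsto> y + s v + a s\<^sup>2 Dg(y)/|Dg(y)|\<close> bends inwards more than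
the sphere of radius \<open>r\<close> and so runs in the ball for small \<open>s > 0\<close>. The claim is that the second derivative of
\<open>g\<close> along this curve, whose first derivative at \<open>0\<close> vanishes, is not negative.
\<close>

lemma minimizer_second_variation:
  assumes g: "\<And>y. g differentiable at y" and H: "(grad g has_derivative H) (at y)"
    and nz: "grad g y \<noteq> 0" and r: "0 < r" "minimizer g y (char_pos g y r, r)"
    and v: "grad g y \<bullet> v = 0" and a: "(norm v)\<^sup>2 < 2 * r * a"
  shows "0 \<le> H v \<bullet> v + 2 * a * norm (grad g y)"
proof (rule ccontr)
  let ?nu = "sgn (grad g y)"
  let ?c = "\<lambda>s::real. y + s *\<^sub>R v + (a * s\<^sup>2) *\<^sub>R ?nu"
  let ?c' = "\<lambda>s::real. v + (2 * a * s) *\<^sub>R ?nu"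
  let ?f' = "\<lambda>s. grad g (?c s) \<bullet> ?c' s"
  assume neg: "\<not> ?thesis"
  have cont: "continuous_on UNIV g"
    using g by (simp add: continuous_at_imp_continuous_on differentiable_imp_continuous_within)
  have nu: "norm ?nu = 1" "?nu \<bullet> v = 0" "grad g y \<bullet> ?nu = norm (grad g y)"
    using nz v by (auto simp: norm_sgn sgn_div_norm dot_square_norm power2_eq_square)
  have c': "(?c has_derivative (\<lambda>h. h *\<^sub>R ?c' s)) (at s)" for s
    by (auto intro!: derivative_eq_intros simp: algebra_simps power2_eq_square)
  have f': "((\<lambda>s. g (?c s)) has_real_derivative ?f' s) (at s)" for s
    using has_derivative_compose[OF c' has_derivative_grad[OF g]]
    by (simp add: has_field_derivative_def mult_commute_abs)
  have "((\<lambda>s. ?f' s) has_derivative (\<lambda>h. grad g (?c 0) \<bullet> (h *\<^sub>R ((2 * a) *\<^sub>R ?nu)) + H (h *\<^sub>R ?c' 0) \<bullet> ?c' 0)) (at 0)"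
  proof (rule has_derivative_inner)
    show "((\<lambda>s. grad g (?c s)) has_derivative (\<lambda>h. H (h *\<^sub>R ?c' 0))) (at 0)"
      using has_derivative_compose[OF c'[of 0], of "grad g" H] H by simp
    show "(?c' has_derivative (\<lambda>h. h *\<^sub>R ((2 * a) *\<^sub>R ?nu))) (at 0)"
      by (auto intro!: derivative_eq_intros simp: algebra_simps)
  qed
  also have "(\<lambda>h. grad g (?c 0) \<bullet> (h *\<^sub>R ((2 * a) *\<^sub>R ?nu)) + H (h *\<^sub>R ?c' 0) \<bullet> ?c' 0)
      = (\<lambda>h. h * (H v \<bullet> v + 2 * a * norm (grad g y)))"
    using nu(3) linear_scale[OF has_derivative_linear[OF H]] by (auto simp: algebra_simps)
  finally have "(?f' has_real_derivative H v \<bullet> v + 2 * a * norm (grad g y)) (at 0)"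
    by (simp add: has_field_derivative_def mult_commute_abs)
  from DERIV_neg_dec_right[OF this] neg v
  obtain d where d: "d > 0" "\<And>h. 0 < h \<Longrightarrow> h < d \<Longrightarrow> ?f' h < 0"
    by force
  have "((\<lambda>s. (norm v)\<^sup>2 + a\<^sup>2 * s\<^sup>2) \<longlongrightarrow> (norm v)\<^sup>2 + a\<^sup>2 * 0\<^sup>2) (at_right (0::real))"
    by (intro tendsto_intros)
  then have "eventually (\<lambda>s. (norm v)\<^sup>2 + a\<^sup>2 * s\<^sup>2 < 2 * r * a) (at_right (0::real))"
    using a by (intro order_tendstoD(2)) auto
  moreover have "eventually (\<lambda>s. 0 < s \<and> s < d) (at_right (0::real))"
    using d(1) eventually_at_right_field by blast
  ultimately have "eventually (\<lambda>s. (norm v)\<^sup>2 + a\<^sup>2 * s\<^sup>2 < 2 * r * a \<and> 0 < s \<and> s < d) (at_right (0::real))"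
    by eventually_elim auto
  then obtain h where h: "(norm v)\<^sup>2 + a\<^sup>2 * h\<^sup>2 < 2 * r * a" "0 < h" "h < d"
    using eventually_happens'[OF trivial_limit_at_right_real] by blast
  have pos: "?c h - char_pos g y r = h *\<^sub>R v + (a * h\<^sup>2 - r) *\<^sub>R ?nu"
    by (simp add: char_pos_eq_sgn algebra_simps)
  have "(norm (?c h - char_pos g y r))\<^sup>2 = h\<^sup>2 * (norm v)\<^sup>2 + (a * h\<^sup>2 - r)\<^sup>2"
    unfolding pos using nu(1,2) norm_add_Pythagorean[of "h *\<^sub>R v" "(a * h\<^sup>2 - r) *\<^sub>R ?nu"]
    by (simp add: orthogonal_def inner_commute power_mult_distrib)
  also have "\<dots> = h\<^sup>2 * ((norm v)\<^sup>2 + a\<^sup>2 * h\<^sup>2 - 2 * r * a) + r\<^sup>2"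
    by (simp add: power2_eq_square algebra_simps)
  also have "\<dots> \<le> r\<^sup>2"
    using h(1) by (simp add: mult_nonneg_nonpos)
  finally have "norm (?c h - char_pos g y r) \<le> r"
    by (rule power2_le_imp_le) (use r(1) in simp)
  then have "?c h \<in> cball (char_pos g y r) r"
    by (simp only: mem_cball dist_norm norm_minus_commute)
  then have "g (?c 0) \<le> g (?c h)"
    using r(2) by (simp add: minimizer_iff[OF cont])
  moreover obtain z where "0 < z" "z < h" "g (?c h) - g (?c 0) = (h - 0) * ?f' z"
    using MVT2[OF h(2), of "\<lambda>s. g (?c s)" ?f'] f' by blast
  moreover from this have "h * ?f' z < 0"
    using d(2)[of z] h(2,3) by (intro mult_pos_neg) auto
  ultimately show False
    by simp
qed

text \<open>
Let \<open>\<nu> = Dg/|Dg|\<close>, with derivative \<open>N\<close>. Since \<open>|\<nu>| = 1\<close>, \<open>N v\<close> is orthogonal to \<open>\<nu>\<close>, so a kernel vector \<open>v\<close> of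
\<open>1 + t N\<close> is tangential, and \<open>N v \<bullet> v = -|v|\<^sup>2/t\<close>. Differentiating \<open>Dg = |Dg| \<nu>\<close> gives
\<open>D\<^sup>2g(v, v) = -|Dg| |v|\<^sup>2/t\<close>, which for \<open>v \<noteq> 0\<close> violates the second-order condition at the larger radius \<open>r\<close>.
\<close>

lemma characteristic_flow_injective:
  assumes g: "\<And>y. g differentiable at y" and H: "(grad g has_derivative H) (at y)"
    and N: "((\<lambda>y. sgn (grad g y)) has_derivative N) (at y)"
    and nz: "grad g y \<noteq> 0" and t: "0 < t" "t < r" and min: "minimizer g y (char_pos g y r, r)"
    and v: "v + t *\<^sub>R N v = 0"
  shows "v = 0"
proof (rule ccontr)
  assume "v \<noteq> 0"
  let ?nu = "\<lambda>y. sgn (grad g y)"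
  have polar: "grad g z = norm (grad g z) *\<^sub>R ?nu z" for z
    by (cases "grad g z = 0") (auto simp: sgn_div_norm)
  have nu: "?nu y \<bullet> ?nu y = 1"
    using nz by (simp add: dot_square_norm norm_sgn)
  have "((\<lambda>z. ?nu z \<bullet> ?nu z) has_derivative (\<lambda>v. ?nu y \<bullet> N v + N v \<bullet> ?nu y)) (at y)"
    by (rule has_derivative_inner[OF N N])
  moreover have "((\<lambda>z. ?nu z \<bullet> ?nu z) has_derivative (\<lambda>v. 0)) (at y)"
  proof (rule has_derivative_transform_eventually)
    show "((\<lambda>z. 1::real) has_derivative (\<lambda>v. 0)) (at y)"
      by simp
    have "eventually (\<lambda>z. grad g z \<noteq> 0) (at y)"
      using has_derivative_continuous[OF H] nz
      by (intro tendsto_imp_eventually_ne[of _ "grad g y"]) (auto simp: continuous_within)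
    then show "eventually (\<lambda>z. 1 = ?nu z \<bullet> ?nu z) (at y)"
      by eventually_elim (simp add: dot_square_norm norm_sgn)
  qed (use nu in auto)
  ultimately have "?nu y \<bullet> N v + N v \<bullet> ?nu y = 0"
    by (metis has_derivative_unique)
  then have Nnu: "?nu y \<bullet> N v = 0"
    by (simp add: inner_commute)
  have "?nu y \<bullet> (v + t *\<^sub>R N v) = 0"
    using v by simp
  then have nuv: "?nu y \<bullet> v = 0"
    using Nnu by (simp add: inner_add_right)
  then have orth: "grad g y \<bullet> v = 0"
    by (subst polar) simp
  obtain R where R: "((\<lambda>z. norm (grad g z)) has_derivative R) (at y)"
    using has_derivative_compose[OF H has_derivative_norm[OF nz]] by blast
  have "(grad g has_derivative (\<lambda>v. norm (grad g y) *\<^sub>R N v + R v *\<^sub>R ?nu y)) (at y)"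
    using has_derivative_scaleR[OF R N] by (simp flip: polar)
  then have "H = (\<lambda>v. norm (grad g y) *\<^sub>R N v + R v *\<^sub>R ?nu y)"
    by (rule has_derivative_unique[OF H])
  then have Hv: "H v \<bullet> v = norm (grad g y) * (N v \<bullet> v)"
    using nuv by (simp add: inner_add_left)
  have "(v + t *\<^sub>R N v) \<bullet> v = 0"
    using v by simp
  then have Nv: "N v \<bullet> v = - (norm v)\<^sup>2 / t"
    using t by (simp add: inner_add_left dot_square_norm field_simps add_eq_0_iff)
  \<comment> \<open>The second variation bounds are weak inequalities, and a radius strictly between \<open>t\<close> and \<open>r\<close> makes them strict.\<close>
  obtain q where q: "t < q" "q < r"
    using t dense by blast
  have "0 \<le> H v \<bullet> v + 2 * ((norm v)\<^sup>2 / (2 * q)) * norm (grad g y)"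
    by (rule minimizer_second_variation[OF g H nz _ min orth])
      (use q t \<open>v \<noteq> 0\<close> in \<open>auto simp: field_simps\<close>)
  then have "0 \<le> norm (grad g y) * ((norm v)\<^sup>2 * (1 / q - 1 / t))"
    by (simp add: Hv Nv algebra_simps)
  moreover have "norm (grad g y) * ((norm v)\<^sup>2 * (1 / q - 1 / t)) < 0"
    using nz \<open>v \<noteq> 0\<close> q t by (intro mult_pos_neg) (auto simp: field_simps)
  ultimately show False
    by simp
qed

section \<open>Smoothness along non-degenerate characteristics\<close>

text \<open>
Differentiating \<open>Y + s \<nu>(Y) = x\<close>, where \<open>\<nu> = Dg/|Dg|\<close>, gives for \<open>DY\<close> a linear system with coefficients that are
\<open>C\<^sup>m\<close> functions of \<open>(Y, s)\<close>. Hence \<open>Y \<in> C\<^sup>j\<close> implies \<open>DY \<in> C\<^sup>j\<close> for \<open>j \<le> m\<close>, and the regularity bootstraps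
up to \<open>C\<^sup>m\<^sup>+\<^sup>1\<close>.
\<close>

lemma Ck_on_foot_map:
  fixes g :: "real^'n \<Rightarrow> real"
  assumes g: "Ck_on (Suc (Suc m)) g UNIV" and V: "open V"
    and nz: "\<And>p. p \<in> V \<Longrightarrow> grad g (Y p) \<noteq> 0"
    and Y': "\<And>p. p \<in> V \<Longrightarrow> (Y has_derivative Y' p) (at p)"
    and eq: "\<And>p q. p \<in> V \<Longrightarrow>
      Y' p q + snd p *\<^sub>R frechet_derivative (\<lambda>y. sgn (grad g y)) (at (Y p)) (Y' p q)
        = fst q - snd q *\<^sub>R sgn (grad g (Y p))"
    and inj: "\<And>p. p \<in> V \<Longrightarrow>
      inj (\<lambda>v. v + snd p *\<^sub>R frechet_derivative (\<lambda>y. sgn (grad g y)) (at (Y p)) v)"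
  shows "Ck_on (Suc m) Y V"
proof -
  let ?S = "{y. grad g y \<noteq> 0}"
  let ?nu = "\<lambda>y. sgn (grad g y)"
  let ?N = "\<lambda>y. frechet_derivative ?nu (at y)"
  let ?A = "\<lambda>p v. v + snd p *\<^sub>R ?N (Y p) v"
  have S: "open ?S"
    using Ck_on_imp_continuous_on[OF Ck_on_grad[OF g]] by (intro open_Collect_neq) auto
  have nu: "Ck_on (Suc m) ?nu ?S"
    by (rule Ck_on_sgn_grad[OF g S]) simp
  have YS: "Y ` V \<subseteq> ?S"
    using nz by auto
  have lin: "linear (?A p)" if "p \<in> V" for p
  proof -
    have "bounded_linear (?N (Y p))"
      using Ck_on_Suc_has_derivative[OF nu, of "Y p"] nz[OF that] by (intro has_derivative_bounded_linear) auto
    then show ?thesis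
      by (intro linear_compose_add linear_ident linear_compose_scale_right bounded_linear.linear)
  qed
  have "Ck_on j Y V" if "j \<le> Suc m" for j
    using that
  proof (induction j)
    case 0
    have "continuous_on V Y"
      using Y' by (intro continuous_at_imp_continuous_on ballI) (rule has_derivative_continuous)
    then show ?case
      by simp
  next
    case (Suc j)
    have Yj: "Ck_on j Y V" and j: "j \<le> m"
      using Suc by auto
    have sndp: "Ck_on j (\<lambda>p. snd p) V"
      by (rule Ck_on_linear[OF bounded_linear_snd V])
    have NY: "Ck_on j (\<lambda>p. ?N (Y p) b) V" for b
      by (rule Ck_on_compose[OF V Ck_on_mono[OF Ck_on_frechet_derivative[OF nu] j] Yj YS])
    have nuY: "Ck_on j (\<lambda>p. ?nu (Y p)) V"
      by (rule Ck_on_compose[OF V Ck_on_mono[OF nu] Yj YS]) (use j in simp)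
    have comp: "Ck_on j (\<lambda>p. f p $ i) V" if "Ck_on j f V" for f :: "_ \<Rightarrow> real^'n" and i
      by (rule Ck_on_bounded_linear[OF bounded_linear_vec_nth V that])
    have "Ck_on j (\<lambda>p. Y' p q) V" for q
    proof (rule Ck_on_linear_system_solution[OF V])
      show "Ck_on j (\<lambda>p. matrix (?A p) $ r $ c) V" for r c
        unfolding matrix_def vec_lambda_beta
        by (intro comp Ck_on_add Ck_on_const Ck_on_scaleR sndp NY V)
      show "Ck_on j (\<lambda>p. (fst q - snd q *\<^sub>R ?nu (Y p)) $ i) V" for i
        by (intro comp Ck_on_diff Ck_on_const Ck_on_scaleR nuY V)
      fix p assume p: "p \<in> V"
      show "det (matrix (?A p)) \<noteq> 0"
        using det_nz_iff_inj[OF lin[OF p]] inj[OF p] by blast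
      show "matrix (?A p) *v Y' p q = fst q - snd q *\<^sub>R ?nu (Y p)"
        using matrix_works[of "?A p"] lin[OF p] eq[OF p] by (simp only: linear_matrix_vector_mul_eq)
    qed
    with Y' show ?case
      by (intro Ck_on_SucI[OF V])
  qed
  from this[OF order_refl] show ?thesis .
qed

text \<open>
The inverse function theorem is applied to \<open>(y, s) \<mapsto> (X(y, s), s)\<close>; it gives a differentiable
inverse, whose higher regularity is \<open>Ck_on_foot_map\<close>.
\<close>

lemma characteristic_flow_inverse:
  fixes g :: "real^'n \<Rightarrow> real"
  assumes g: "Ck_on (Suc (Suc m)) g UNIV" and nz: "grad g y0 \<noteq> 0"
    and inj0: "\<And>v. v + t *\<^sub>R frechet_derivative (\<lambda>y. sgn (grad g y)) (at y0) v = 0 \<Longrightarrow> v = 0"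
  shows "\<exists>T V Y. open T \<and> (y0, t) \<in> T \<and> open V \<and> (char_pos g y0 t, t) \<in> V \<and> Ck_on (Suc m) Y V
    \<and> (\<forall>y s. (y, s) \<in> T \<longrightarrow> grad g y \<noteq> 0 \<and> Y (char_pos g y s, s) = y)"
proof -
  let ?S = "{y. grad g y \<noteq> 0}"
  let ?nu = "\<lambda>y. sgn (grad g y)"
  let ?N = "\<lambda>y. frechet_derivative ?nu (at y)"
  let ?F = "\<lambda>p. (char_pos g (fst p) (snd p), snd p)"
  let ?F' = "\<lambda>p q. (fst q + (snd p *\<^sub>R ?N (fst p) (fst q) + snd q *\<^sub>R ?nu (fst p)), snd q)"
  have S: "open ?S"
    using Ck_on_imp_continuous_on[OF Ck_on_grad[OF g]] by (intro open_Collect_neq) auto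
  then have SU: "open (?S \<times> (UNIV :: real set))"
    by (simp add: open_Times)
  have nu: "Ck_on (Suc m) ?nu ?S"
    by (rule Ck_on_sgn_grad[OF g S]) simp
  have F': "(?F has_derivative ?F' p) (at p)" if "p \<in> ?S \<times> UNIV" for p
  proof -
    have "(?nu has_derivative ?N (fst p)) (at (fst p))"
      using that by (intro Ck_on_Suc_has_derivative[OF nu]) auto
    then have "((\<lambda>p. ?nu (fst p)) has_derivative (\<lambda>q. ?N (fst p) (fst q))) (at p)"
      by (rule has_derivative_compose[OF has_derivative_fst[OF has_derivative_ident]])
    then show ?thesis
      unfolding char_pos_eq_sgn
      by (intro has_derivative_Pair has_derivative_add has_derivative_scaleR has_derivative_fst
          has_derivative_snd has_derivative_ident)
  qed
  have bl: "bounded_linear (?F' p)" if "p \<in> ?S \<times> UNIV" for p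
    using F'[OF that] by (rule has_derivative_bounded_linear)
  define f' where "f' p = Blinfun (?F' p)" for p
  have f': "blinfun_apply (f' p) = ?F' p" if "p \<in> ?S \<times> UNIV" for p
    unfolding f'_def using bl[OF that] by (rule bounded_linear_Blinfun_apply)
  have contf': "continuous_on (?S \<times> UNIV) f'"
  proof (rule continuous_on_blinfun_componentwise)
    fix q :: "(real^'n) \<times> real"
    have nuc: "continuous_on (?S \<times> (UNIV :: real set)) (\<lambda>p. ?nu (fst p))"
      and Nc: "continuous_on (?S \<times> (UNIV :: real set)) (\<lambda>p. ?N (fst p) (fst q))"
      by (rule continuous_on_compose2[OF Ck_on_imp_continuous_on[OF nu] continuous_on_fst[OF continuous_on_id]]
          continuous_on_compose2[OF Ck_on_imp_continuous_on[OF Ck_on_frechet_derivative[OF nu]]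
            continuous_on_fst[OF continuous_on_id]], force)+
    have "continuous_on (?S \<times> UNIV) (\<lambda>p. ?F' p q)"
      by (intro continuous_intros nuc Nc)
    then show "continuous_on (?S \<times> UNIV) (\<lambda>p. blinfun_apply (f' p) q)"
      by (rule continuous_on_cong[THEN iffD1, rotated 2]) (simp_all add: f')
  qed
  have p0: "(y0, t) \<in> ?S \<times> UNIV"
    using nz by simp
  have lin0: "linear (?F' (y0, t))"
    by (rule bounded_linear.linear[OF bl[OF p0]])
  have "inj (?F' (y0, t))"
    unfolding linear_injective_0[OF lin0]
  proof (intro allI impI)
    fix q :: "(real^'n) \<times> real"
    assume q: "?F' (y0, t) q = 0"
    then have snd: "snd q = 0"
      by (simp add: zero_prod_def)
    with q have "fst q + t *\<^sub>R ?N y0 (fst q) = 0"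
      by (simp add: zero_prod_def)
    from inj0[OF this] snd show "q = 0"
      by (simp add: prod_eq_iff)
  qed
  from linear_injective_left_inverse[OF lin0 this]
  obtain L where L: "linear L" "L \<circ> ?F' (y0, t) = id"
    by (elim exE conjE)
  have inv: "Blinfun L o\<^sub>L f' (y0, t) = id_blinfun"
  proof (rule blinfun_eqI)
    fix q :: "(real^'n) \<times> real"
    have "bounded_linear L"
      using L(1) by (simp only: linear_conv_bounded_linear)
    moreover have "L (?F' (y0, t) q) = q"
      using fun_cong[OF L(2), of q] by (simp only: o_apply id_apply)
    ultimately show "blinfun_apply (Blinfun L o\<^sub>L f' (y0, t)) q = blinfun_apply id_blinfun q"
      by (simp only: blinfun_apply_blinfun_compose f'[OF p0] bounded_linear_Blinfun_apply
          blinfun_apply_id_blinfun)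
  qed
  have derf: "(?F has_derivative blinfun_apply (f' p)) (at p)" if "p \<in> ?S \<times> UNIV" for p
    unfolding f'[OF that] by (rule F'[OF that])
  obtain U V G G' where U: "open U" "U \<subseteq> ?S \<times> UNIV" "(y0, t) \<in> U"
    and V: "open V" "?F (y0, t) \<in> V" and hom: "homeomorphism U V ?F G"
    and G': "\<And>p. p \<in> V \<Longrightarrow> (G has_derivative G' p) (at p)"
      "\<And>p. p \<in> V \<Longrightarrow> G' p = inv (blinfun_apply (f' (G p)))"
      "\<And>p. p \<in> V \<Longrightarrow> bij (blinfun_apply (f' (G p)))"
  proof (rule inverse_function_theorem[OF SU derf contf' p0 inv])
    fix U V G G'
    assume "open U" "U \<subseteq> ?S \<times> UNIV" "(y0, t) \<in> U" "open V" "?F (y0, t) \<in> V"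
      "homeomorphism U V ?F G"
      "\<And>p. p \<in> V \<Longrightarrow> (G has_derivative G' p) (at p)"
      "\<And>p. p \<in> V \<Longrightarrow> G' p = inv (blinfun_apply (f' (G p)))"
      "\<And>p. p \<in> V \<Longrightarrow> bij (blinfun_apply (f' (G p)))"
    then show thesis
      by (rule that)
  qed
  have GU: "G p \<in> ?S \<times> UNIV" "?F (G p) = p" if "p \<in> V" for p
    using homeomorphism_apply2[OF hom that] homeomorphism_image2[OF hom] U(2) that by blast+
  have snd_G: "snd (G p) = snd p" if "p \<in> V" for p
    using GU(2)[OF that] by (metis snd_conv)
  have F'G': "?F' (G p) (G' p q) = q" if "p \<in> V" for p q
    using G'(2,3)[OF that] f'[OF GU(1)[OF that]] by (metis bij_inv_eq_iff)
  have "Ck_on (Suc m) (\<lambda>p. fst (G p)) V"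
  proof (rule Ck_on_foot_map[OF g V(1)])
    fix p assume p: "p \<in> V"
    show "grad g (fst (G p)) \<noteq> 0"
      using GU(1)[OF p] by auto
    show "((\<lambda>p. fst (G p)) has_derivative (\<lambda>q. fst (G' p q))) (at p)"
      by (rule has_derivative_fst[OF G'(1)[OF p]])
    show "fst (G' p q) + snd p *\<^sub>R ?N (fst (G p)) (fst (G' p q)) = fst q - snd q *\<^sub>R ?nu (fst (G p))" for q
    proof -
      have "fst (?F' (G p) (G' p q)) = fst q" "snd (?F' (G p) (G' p q)) = snd q"
        by (simp_all only: F'G'[OF p])
      then show ?thesis
        by (simp add: snd_G[OF p] algebra_simps)
    qed
    have inj: "inj (?F' (G p))"
      using G'(3)[OF p] f'[OF GU(1)[OF p]] by (simp add: bij_is_inj)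
    show "inj (\<lambda>v. v + snd p *\<^sub>R ?N (fst (G p)) v)"
    proof (rule injI)
      fix v w
      assume "v + snd p *\<^sub>R ?N (fst (G p)) v = w + snd p *\<^sub>R ?N (fst (G p)) w"
      then have "?F' (G p) (v, 0) = ?F' (G p) (w, 0)"
        by (simp add: snd_G[OF p])
      with inj have "(v, 0::real) = (w, 0)"
        by (rule injD)
      then show "v = w"
        by simp
    qed
  qed
  moreover have "grad g y \<noteq> 0 \<and> fst (G (char_pos g y s, s)) = y" if "(y, s) \<in> U" for y s
  proof -
    have "G (?F (y, s)) = (y, s)"
      by (rule homeomorphism_apply1[OF hom that])
    then show ?thesis
      using U(2) that by auto
  qed
  ultimately show ?thesis
    using U(1,3) V by (intro exI[of _ U] exI[of _ V] exI[of _ "\<lambda>p. fst (G p)"]) auto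
qed

section \<open>Regularity of the Hopf--Lax solution\<close>

text \<open>
Near \<open>(x, t)\<close> the point \<open>Y p\<close> is a minimizer for \<open>p\<close>, so \<open>u = g \<circ> Y\<close>, one order of differentiability short of the
claim. Knowing that \<open>u\<close> is differentiable, its derivative at \<open>p\<close> can be read off from \<open>g\<close> at \<open>Y p\<close> without
differentiating \<open>Y\<close>, and this recovers the lost order.
\<close>

lemma hopf_lax_Ck_near_regular_point:
  fixes g :: "real^'n \<Rightarrow> real"
  assumes g: "Ck_on (Suc (Suc m)) g UNIV" and nz: "grad g y0 \<noteq> 0"
    and uniq: "unique_minimizer g y0 (x, t)" and t: "0 < t" "t < r"
    and r: "minimizer g y0 (char_pos g y0 r, r)"
  shows "\<exists>U. open U \<and> (x, t) \<in> U \<and> U \<subseteq> UNIV \<times> {0<..} \<and> Ck_on (Suc (Suc m)) (hopf_lax g) U"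
proof -
  let ?S = "{y. grad g y \<noteq> 0}"
  let ?nu = "\<lambda>y. sgn (grad g y)"
  have cont: "continuous_on UNIV g"
    by (rule Ck_on_imp_continuous_on[OF g])
  have diff: "g differentiable at y" for y
    using Ck_on_Suc_has_derivative[OF g UNIV_I] unfolding differentiable_def by blast
  have S: "open ?S"
    using Ck_on_imp_continuous_on[OF Ck_on_grad[OF g]] by (intro open_Collect_neq) auto
  have nu: "Ck_on (Suc m) ?nu ?S"
    by (rule Ck_on_sgn_grad[OF g S]) simp
  have x: "x = char_pos g y0 t"
    using uniq by (intro minimizer_on_characteristic[OF cont diff nz]) (simp add: unique_minimizer_def)
  have inj: "v = 0" if "v + t *\<^sub>R frechet_derivative ?nu (at y0) v = 0" for v
    by (rule characteristic_flow_injective[OF diff Ck_on_Suc_has_derivative[OF Ck_on_grad[OF g] UNIV_I]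
          Ck_on_Suc_has_derivative[OF nu] nz t r that]) (use nz in simp)
  have "\<exists>T V Y. open T \<and> (y0, t) \<in> T \<and> open V \<and> (char_pos g y0 t, t) \<in> V \<and> Ck_on (Suc m) Y V
    \<and> (\<forall>y s. (y, s) \<in> T \<longrightarrow> grad g y \<noteq> 0 \<and> Y (char_pos g y s, s) = y)"
    by (rule characteristic_flow_inverse[OF g nz]) (rule inj)
  then obtain T V Y where T: "open T" "(y0, t) \<in> T" and V: "open V" "(x, t) \<in> V"
    and Y: "Ck_on (Suc m) Y V"
    and Y_char: "\<forall>y s. (y, s) \<in> T \<longrightarrow> grad g y \<noteq> 0 \<and> Y (char_pos g y s, s) = y"
    unfolding x by (elim exE conjE)
  obtain A B where AB: "open A" "open B" "y0 \<in> A" "t \<in> B" "A \<times> B \<subseteq> T"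
    using open_prod_elim[OF T] by (metis mem_Sigma_iff)
  have "\<exists>N. open N \<and> (x, t) \<in> N \<and> N \<subseteq> UNIV \<times> {0<..}
      \<and> (\<forall>p\<in>N. \<forall>y. minimizer g y p \<longrightarrow> y \<in> A)"
    by (rule minimizers_nearby[OF cont t(1) AB(1)]) (use uniq AB(3) in \<open>auto simp: unique_minimizer_def\<close>)
  then obtain N where N: "open N" "(x, t) \<in> N" "N \<subseteq> UNIV \<times> {0<..}"
    and near: "\<forall>p\<in>N. \<forall>y. minimizer g y p \<longrightarrow> y \<in> A"
    by (elim exE conjE)
  define U where "U = N \<inter> V \<inter> UNIV \<times> B"
  have U: "open U" "(x, t) \<in> U" "U \<subseteq> V"
    using N V AB by (auto simp: U_def intro!: open_Int open_Times)
  have pos: "0 < snd p" if "p \<in> U" for p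
    using that N(3) by (auto simp: U_def)
  have min_Y: "minimizer g (Y p) p \<and> grad g (Y p) \<noteq> 0" if p: "p \<in> U" for p
  proof -
    obtain x' s where xs: "p = (x', s)"
      by (cases p)
    obtain y where y: "minimizer g y (x', s)"
      using minimizer_exists[OF cont, of s x'] pos[OF p] xs by auto
    have "y \<in> A" "s \<in> B"
      using near y p by (auto simp: U_def xs)
    then have "(y, s) \<in> T"
      using AB(5) by blast
    then have "grad g y \<noteq> 0" "Y (char_pos g y s, s) = y"
      using Y_char by auto
    moreover from this have "x' = char_pos g y s"
      by (intro minimizer_on_characteristic[OF cont diff _ y])
    ultimately show ?thesis
      using y by (simp add: xs)
  qed
  have YU: "Ck_on (Suc m) Y U"
    by (rule Ck_on_subset[OF Y U(3)])
  have "Ck_on (Suc m) (\<lambda>p. g (Y p)) U"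
    by (rule Ck_on_compose[OF U(1) Ck_on_SucD[OF g] YU]) simp
  then have u1: "Ck_on (Suc m) (hopf_lax g) U"
    by (rule Ck_on_cong[OF U(1), rotated]) (use min_Y hopf_lax_eq in metis)
  have u': "(hopf_lax g has_derivative (\<lambda>q. grad g (Y p) \<bullet> (fst q - snd q *\<^sub>R ?nu (Y p)))) (at p)"
    if p: "p \<in> U" for p
  proof -
    obtain x' s where xs: "p = (x', s)"
      by (cases p)
    have Yp: "minimizer g (Y p) (x', s)" "grad g (Y p) \<noteq> 0" "0 < s"
      using min_Y[OF p] pos[OF p] by (auto simp: xs)
    have "(x' - Y p) /\<^sub>R s = ?nu (Y p)"
      using minimizer_on_characteristic[OF cont diff Yp(2,1)] Yp(3) by (simp add: char_pos_eq_sgn)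
    moreover have "hopf_lax g differentiable at (x', s)"
      using Ck_on_Suc_has_derivative[OF u1 p] unfolding xs differentiable_def by blast
    ultimately show ?thesis
      using hopf_lax_derivative[OF cont diff Yp(1,3)] by (simp only: xs)
  qed
  have Du: "Ck_on (Suc m) (\<lambda>p. grad g (Y p) \<bullet> (fst q - snd q *\<^sub>R ?nu (Y p))) U" for q
  proof -
    have "Ck_on (Suc m) (\<lambda>p. grad g (Y p)) U"
      by (rule Ck_on_compose[OF U(1) Ck_on_grad[OF g] YU]) simp
    moreover have "Ck_on (Suc m) (\<lambda>p. ?nu (Y p)) U"
      by (rule Ck_on_compose[OF U(1) nu YU]) (use min_Y in auto)
    ultimately show ?thesis
      by (intro Ck_on_inner Ck_on_diff Ck_on_scaleR Ck_on_const U(1))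
  qed
  have "Ck_on (Suc (Suc m)) (hopf_lax g) U"
    by (rule Ck_on_SucI[OF U(1) u' Du])
  with U(1,2) pos show ?thesis
    by (intro exI[of _ U]) auto
qed

lemma ennreal_less_Sup_times:
  assumes "ennreal t < Sup {ennreal s | s. 0 < s \<and> P s}"
  shows "\<exists>s>t. P s"
proof -
  obtain s where s: "P s" "ennreal t < ennreal s"
    using assms unfolding less_Sup_iff by blast
  have "\<not> s \<le> t"
  proof
    assume "s \<le> t"
    then have "ennreal s \<le> ennreal t"
      by (rule ennreal_leI)
    with s(2) show False
      by simp
  qed
  with s(1) show ?thesis
    by (intro exI[of _ s]) simp
qed

theorem theorem5p10:
  fixes g :: "real ^ 'n \<Rightarrow> real" and k :: nat and x :: "real ^ 'n" and t :: real
  assumes "k \<ge> 2"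
    and "Ck_on k g UNIV"
    and "(x, t) \<in> (UNIV \<times> {0<..}) - (Sigma_set g \<union> T1_set g \<union> P0_set g)"
  shows "\<exists>U. open U \<and> (x, t) \<in> U \<and> U \<subseteq> UNIV \<times> {0<..} \<and> Ck_on k (hopf_lax g) U"
proof -
  obtain m where k: "k = Suc (Suc m)"
    using assms(1) by (metis add_2_eq_Suc le_Suc_ex)
  have g: "Ck_on (Suc (Suc m)) g UNIV"
    using assms(2) by (simp only: k)
  have t: "0 < t" and u: "hopf_lax g differentiable at (x, t)"
    and T1: "(x, t) \<notin> T1_set g" and P0: "(x, t) \<notin> P0_set g"
    using assms(3) by (auto simp: Sigma_set_def)
  have cont: "continuous_on UNIV g"
    by (rule Ck_on_imp_continuous_on[OF g])
  have diff: "g differentiable at y" for y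
    using Ck_on_Suc_has_derivative[OF g UNIV_I] unfolding differentiable_def by blast
  show ?thesis
  proof (cases "\<exists>y. minimizer g y (x, t) \<and> grad g y \<noteq> 0")
    case True
    then obtain y0 where y0: "minimizer g y0 (x, t)" "grad g y0 \<noteq> 0"
      by blast
    have x: "x = char_pos g y0 t"
      by (rule minimizer_on_characteristic[OF cont diff y0(2,1)])
    have "z = y0" if z: "minimizer g z (x, t)" for z
    proof -
      have same: "grad g z = grad g y0"
        by (rule minimizers_same_grad[OF cont diff diff t u z y0(1)])
      have "x = char_pos g z t"
        using y0(2) same by (intro minimizer_on_characteristic[OF cont diff _ z]) simp
      with x show ?thesis
        by (simp add: char_pos_eq_sgn same)
    qed
    with y0(1) have uniq: "unique_minimizer g y0 (x, t)"
      unfolding unique_minimizer_def by blast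
    have t_le: "ennreal t \<le> ts g y0"
      unfolding ts_def
    proof (rule Inf_greatest, clarify)
      fix s assume s: "0 < s" "\<not> minimizer g y0 (char_pos g y0 s, s)"
      have "\<not> s \<le> t"
      proof
        assume "s \<le> t"
        then have "minimizer g y0 (y0 + s *\<^sub>R sgn (grad g y0), s)"
          using y0 s(1) x by (intro minimizer_backwards[OF cont, of _ s t])
            (auto simp: norm_sgn char_pos_eq_sgn)
        with s(2) show False
          by (simp add: char_pos_eq_sgn)
      qed
      then show "ennreal t \<le> ennreal s"
        by (intro ennreal_leI) simp
    qed
    \<comment> \<open>Otherwise \<open>(x, t)\<close> would belong to \<open>T(M)\<close>, and then to \<open>T\<^sub>1\<close> as its minimizer is unique.\<close>
    have "ennreal t < ts_bar g y0"
    proof (rule ccontr)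
      assume "\<not> ennreal t < ts_bar g y0"
      then have le: "ts_bar g y0 \<le> ennreal t"
        by simp
      have "ts_bar g y0 < \<infinity>"
        using le by (rule le_less_trans) simp
      with y0(2) have "y0 \<in> M_set g"
        unfolding M_set_def by blast
      then have "(x, t) \<in> TM_set g"
        unfolding TM_set_def using t le t_le unfolding x
        by (intro CollectI exI[of _ y0] exI[of _ t] conjI refl) simp_all
      with uniq T1 show False
        unfolding T1_set_def by blast
    qed
    then have "\<exists>r>t. unique_minimizer g y0 (char_pos g y0 r, r)"
      unfolding ts_bar_def by (rule ennreal_less_Sup_times)
    then obtain r where "t < r" "minimizer g y0 (char_pos g y0 r, r)"
      unfolding unique_minimizer_def by blast
    then show ?thesis
      unfolding k by (rule hopf_lax_Ck_near_regular_point[OF g y0(2) uniq t])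
  next
    case False
    have "y \<in> ball x t" if y: "minimizer g y (x, t)" for y
    proof (rule ccontr)
      assume "y \<notin> ball x t"
      then have yt: "norm (x - y) = t"
        using y by (simp add: minimizer_def dist_norm norm_minus_commute)
      let ?P = "(x - y) /\<^sub>R t"
      have P: "norm ?P = 1" and x: "x = y + t *\<^sub>R ?P"
        using yt t by auto
      have "ennreal t \<le> ts_crit g y ?P"
        unfolding ts_crit_def
      proof (rule Inf_greatest, clarify)
        fix s assume s: "0 < s" "\<not> minimizer g y (y + s *\<^sub>R ?P, s)"
        have "\<not> s \<le> t"
          using minimizer_backwards[OF cont, of ?P s t y] s P y x by auto
        then show "ennreal t \<le> ennreal s"
          by (intro ennreal_leI) simp
      qed
      moreover have "grad g y = 0"
        using False y by blast
      ultimately have "(x, t) \<in> P0_set g"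
        unfolding P0_set_def using P x t by (intro CollectI exI[of _ y] exI[of _ ?P] exI[of _ t]) simp
      with P0 show False ..
    qed
    then have "\<exists>U c. open U \<and> (x, t) \<in> U \<and> U \<subseteq> UNIV \<times> {0<..} \<and> (\<forall>p\<in>U. hopf_lax g p = c)"
      by (rule hopf_lax_locally_constant[OF cont t])
    then obtain U c where U: "open U" "(x, t) \<in> U" "U \<subseteq> UNIV \<times> {0<..}"
      and c: "\<forall>p\<in>U. hopf_lax g p = c"
      by (elim exE conjE)
    have "Ck_on k (hopf_lax g) U"
      by (rule Ck_on_cong[OF U(1) _ Ck_on_const[OF U(1), of k c]]) (use c in simp)
    with U show ?thesis
      by blast
  qed
qed

end
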